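(* Let $G$ and $H$ be two hamiltonian decomposable digraphs such that $|V(G)|$ is even, $|V(H)|>3$, and $H$ is neither a directed cycle nor a complete symmetric digraph. Then the wreath product $G\wr H$ is hamiltonian decomposable, except possibly when all three of the following hold: $G$ is a directed cycle, $|V(H)|$ is even, and $H$ admits a decomposition into an odd number of directed hamiltonian cycles. (That is, whenever at least one of these three conditions fails, $G\wr H$ is hamiltonian decomposable.)
   Context: All digraphs are finite and strict (no loops and no repeated arcs; a pair of opposite arcs $(x,y),(y,x)$ is allowed, so a directed cycle of length 2 is allowed). The wreath product $G\wr H$ of digraphs $G$ and $H$ is the digraph on vertex set $V(G)\times V(H)$ with an arc from $(g_1,h_1)$ to $(g_2,h_2)$ if and only if there is an arc from $g_1$ to $g_2$ in $G$, or $g_1=g_2$ and there is an arc from $h_1$ to $h_2$ in $H$. A decomposition of a digraph $G$ is a set of pairwise arc-disjoint subdigraphs of $G$ whose arc sets have union $A(G)$. A digraph is hamiltonian decomposable if it admits a decomposition into (one or more) directed hamiltonian cycles. The complete symmetric digraph on $m$ vertices has all arcs $(x,y)$ with $x\neq y$. *)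

theory Defs
  imports "Graph_Theory.Graph_Theory"
begin

text \<open>
  Finite strict digraphs are the members of \<^locale>\<open>pair_digraph\<close>: a finite vertex set and
  a finite irreflexive set of ordered pairs as arcs, opposite arcs being allowed.
\<close>

definition wreath :: "'a pair_pre_digraph \<Rightarrow> 'b pair_pre_digraph \<Rightarrow> ('a \<times> 'b) pair_pre_digraph"
  where
  "wreath G H =
    \<lparr> pverts = pverts G \<times> pverts H,
      parcs = {((g1, h1), (g2, h2)) | g1 h1 g2 h2.
        (g1, h1) \<in> pverts G \<times> pverts H \<and> (g2, h2) \<in> pverts G \<times> pverts H \<and>
        ((g1, g2) \<in> parcs G \<or> g1 = g2 \<and> (h1, h2) \<in> parcs H)} \<rparr>"

text \<open>
  A closed walk satisfying \<^term>\<open>pre_digraph.cycle\<close> may be a loop; loops are excluded here by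
  \<^locale>\<open>pair_digraph\<close>, so a directed cycle has length at least 2.  The vertices visited
  by a closed walk are the tails of its arcs.
\<close>

definition directed_cycle :: "'a pair_pre_digraph \<Rightarrow> bool" where
  "directed_cycle C \<longleftrightarrow> pair_digraph C \<and>
    (\<exists>p. pre_digraph.cycle (with_proj C) p \<and> parcs C = set p \<and> pverts C = fst ` set p)"

definition complete_symmetric :: "'a pair_pre_digraph \<Rightarrow> bool" where
  "complete_symmetric D \<longleftrightarrow> (\<exists>n. complete_digraph n (with_proj D))"

definition decomposition :: "'a pair_pre_digraph \<Rightarrow> 'a pair_pre_digraph set \<Rightarrow> bool" where
  "decomposition D \<C> \<longleftrightarrow>
    (\<forall>C\<in>\<C>. subgraph (with_proj C) (with_proj D)) \<and>
    pairwise (\<lambda>C C'. parcs C \<inter> parcs C' = {}) \<C> \<and>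
    (\<Union>C\<in>\<C>. parcs C) = parcs D"

definition hamiltonian_cycle :: "'a pair_pre_digraph \<Rightarrow> 'a pair_pre_digraph \<Rightarrow> bool" where
  "hamiltonian_cycle D C \<longleftrightarrow> spanning (with_proj C) (with_proj D) \<and> directed_cycle C"

definition hamiltonian_decomposition ::
    "'a pair_pre_digraph \<Rightarrow> 'a pair_pre_digraph set \<Rightarrow> bool" where
  "hamiltonian_decomposition D \<C> \<longleftrightarrow>
    decomposition D \<C> \<and> \<C> \<noteq> {} \<and> (\<forall>C\<in>\<C>. hamiltonian_cycle D C)"

definition hamiltonian_decomposable :: "'a pair_pre_digraph \<Rightarrow> bool" where
  "hamiltonian_decomposable D \<longleftrightarrow> (\<exists>\<C>. hamiltonian_decomposition D \<C>)"

lemma pair_digraph_wreath: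
  assumes "pair_digraph G" "pair_digraph H"
  shows "pair_digraph (wreath G H)"
proof -
  interpret G: pair_digraph G by fact
  interpret H: pair_digraph H by fact
  have fin: "finite (pverts G \<times> pverts H)"
    using G.pair_finite_verts H.pair_finite_verts by simp
  have "parcs (wreath G H) \<subseteq> (pverts G \<times> pverts H) \<times> (pverts G \<times> pverts H)"
    by (auto simp: wreath_def)
  then have "finite (parcs (wreath G H))"
    using fin finite_subset by blast
  then show ?thesis
    using fin by unfold_locales (auto simp: wreath_def dest: G.no_loops' H.no_loops')
qed

end

theory Submission
  imports Defs "HOL-Combinatorics.Transposition" "HOL-Library.Multiset"
begin

text \<open>
  A directed hamiltonian cycle is a permutation of the vertex set with a single orbit.  Fix a
  vertex \<open>z\<close> of \<open>H\<close> and let \<open>K\<close> be its set of out-neighbours, one for each cycle of the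
  decomposition of \<open>H\<close>; the hypotheses on \<open>H\<close> say exactly that \<open>2 \<le> |K| \<le> |V(H)| - 2\<close>.  Along
  one hamiltonian cycle \<open>f0\<close> of \<open>G\<close>, every cycle \<open>d\<close> of \<open>H\<close> is spliced over all copies of \<open>H\<close>
  by replacing each arc \<open>(z, d z)\<close> by the arc from \<open>z\<close> to \<open>d z\<close> in the next copy.  This leaves
  the arcs \<open>(z, k)\<close>, \<open>k \<in> K\<close>, inside each copy and takes away the jumps \<open>z \<rightarrow> k\<close> between
  consecutive copies.

  The jumps over each hamiltonian cycle of \<open>G\<close> are split by a Latin square: the \<open>k\<close>-th cycle uses
  the rows \<open>a k\<close> and \<open>(a k)\<inverse>\<close> alternately (\<open>|V(G)|\<close> is even), except for a last row
  \<open>(a k)\<inverse> \<circ> \<gamma>\<close> with \<open>\<gamma>\<close> cyclic, so that its return map is conjugate to \<open>\<gamma>\<close>.  Along \<open>f0\<close> the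
  rows \<open>k \<in> K\<close> must send \<open>z\<close> to \<open>k\<close> in every layer, and then \<open>z \<rightarrow> k\<close> is replaced by the arc
  inside the copy.  In the last row this is achieved by exchanging the symbols \<open>z\<close> and
  \<open>c = \<gamma> z\<close> in the rows of \<open>K\<close>, which keeps the square Latin as soon as the positions of \<open>z\<close> and
  \<open>c\<close> differ by a derangement preserving \<open>K\<close>; such a pair of symbols extends to a Latin
  square by Hall's theorem.  The return map becomes conjugate to the cycle \<open>\<gamma>\<close> with \<open>z\<close> cut out.
\<close>

section \<open>Maps with a single orbit\<close>

text \<open>A single cycle is encoded by minimality: no proper nonempty part of \<open>X\<close> is
  closed under \<open>f\<close>. Injectivity follows from finiteness, and proving cyclicity amounts
  to letting a nonempty closed set grow until it fills \<open>X\<close>.\<close>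

definition cyclic_map :: "'a set \<Rightarrow> ('a \<Rightarrow> 'a) \<Rightarrow> bool" where
  "cyclic_map X f \<longleftrightarrow> finite X \<and> X \<noteq> {} \<and> f ` X \<subseteq> X \<and>
    (\<forall>A. A \<subseteq> X \<and> A \<noteq> {} \<and> f ` A \<subseteq> A \<longrightarrow> A = X)"

section \<open>Closure, induction, enumeration and surgery of cycles\<close>

lemma cyclic_mapI:
  assumes "finite X" "X \<noteq> {}" "\<And>x. x \<in> X \<Longrightarrow> f x \<in> X"
    and "\<And>A. A \<subseteq> X \<Longrightarrow> A \<noteq> {} \<Longrightarrow> (\<And>x. x \<in> A \<Longrightarrow> f x \<in> A) \<Longrightarrow> X \<subseteq> A"
  shows "cyclic_map X f"
  unfolding cyclic_map_def
proof (intro conjI allI impI)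
  show "f ` X \<subseteq> X" using assms(3) by blast
  fix A assume "A \<subseteq> X \<and> A \<noteq> {} \<and> f ` A \<subseteq> A"
  then show "A = X" using assms(4)[of A] by blast
qed (use assms in auto)

lemma cyclic_map_finite: "cyclic_map X f \<Longrightarrow> finite X"
  and cyclic_map_nonempty: "cyclic_map X f \<Longrightarrow> X \<noteq> {}"
  and cyclic_map_closed: "cyclic_map X f \<Longrightarrow> x \<in> X \<Longrightarrow> f x \<in> X"
  by (auto simp: cyclic_map_def)

lemma cyclic_map_minimal:
  "cyclic_map X f \<Longrightarrow> A \<subseteq> X \<Longrightarrow> A \<noteq> {} \<Longrightarrow> (\<And>x. x \<in> A \<Longrightarrow> f x \<in> A) \<Longrightarrow> A = X"
  unfolding cyclic_map_def by (metis image_subsetI)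

lemma cyclic_map_induct [consumes 3, case_names base step]:
  assumes "cyclic_map X f" "x \<in> X" "y \<in> X"
    and "P x" "\<And>v. v \<in> X \<Longrightarrow> P v \<Longrightarrow> P (f v)"
  shows "P y"
proof -
  have "{v \<in> X. P v} = X"
    using assms by (intro cyclic_map_minimal[OF assms(1)]) (auto dest: cyclic_map_closed)
  then show ?thesis using assms(3) by blast
qed

lemma cyclic_map_bij:
  assumes "cyclic_map X f"
  shows "bij_betw f X X"
proof -
  have "f ` X = X"
    using assms by (intro cyclic_map_minimal[OF assms]) (auto simp: cyclic_map_def)
  then show ?thesis
    using cyclic_map_finite[OF assms] by (simp add: bij_betw_def eq_card_imp_inj_on)
qed

lemma cyclic_map_preimage:
  assumes "cyclic_map X f" "y \<in> X"
  obtains x where "x \<in> X" "f x = y"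
proof -
  have "y \<in> f ` X" using bij_betw_imp_surj_on[OF cyclic_map_bij[OF assms(1)]] assms(2) by simp
  then show thesis using that by (elim imageE) simp
qed

lemma cyclic_map_no_fixed_point:
  assumes "cyclic_map X f" "card X \<noteq> 1" "x \<in> X"
  shows "f x \<noteq> x"
proof
  assume "f x = x"
  then have "{x} = X" using assms by (intro cyclic_map_minimal[OF assms(1)]) auto
  then show False using assms(2) by auto
qed

text \<open>Take the first \<open>j\<close> whose iterate repeats an earlier one, number
  \<open>i\<close>. The iterates from \<open>i\<close> to \<open>j - 1\<close> are closed under
  \<open>f\<close>, hence exhaust \<open>X\<close>; since they contain the starting point,
  \<open>i = 0\<close>.\<close>

lemma cyclic_map_enum:
  assumes "cyclic_map X f" "x \<in> X"
  shows "inj_on (\<lambda>j. (f ^^ j) x) {..<card X}"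
    and "(\<lambda>j. (f ^^ j) x) ` {..<card X} = X"
    and "(f ^^ card X) x = x"
proof -
  define e where "e j = (f ^^ j) x" for j
  have e0: "e 0 = x" and eS: "e (Suc j) = f (e j)" for j by (auto simp: e_def)
  have eX: "e j \<in> X" for j
    by (induct j) (auto simp: e0 eS assms intro: cyclic_map_closed)
  have "\<not> inj e"
    using cyclic_map_finite[OF assms(1)] eX finite_imageD[of e UNIV] infinite_UNIV_nat
    by (metis finite_subset image_subsetI)
  then have "\<exists>j. \<exists>i<j. e i = e j" by (metis injI linorder_neqE_nat)
  then obtain j where j: "\<exists>i<j. e i = e j" and least: "\<And>j'. j' < j \<Longrightarrow> \<not> (\<exists>i<j'. e i = e j')"
    using exists_least_iff[of "\<lambda>j. \<exists>i<j. e i = e j"] by blast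
  then obtain i where i: "i < j" "e i = e j" by blast
  have inj: "inj_on e {..<j}"
    by (rule inj_onI) (metis least lessThan_iff linorder_neqE_nat)
  have "e ` {i..<j} = X"
  proof (rule cyclic_map_minimal[OF assms(1)])
    fix y assume "y \<in> e ` {i..<j}"
    then obtain l where l: "i \<le> l" "l < j" "y = e l" by auto
    show "f y \<in> e ` {i..<j}"
      using l i eS[of l, symmetric] by (cases "Suc l = j") (auto simp del: image_eqI intro: image_eqI[of _ e i])
  qed (use i eX in auto)
  then obtain l where "l \<in> {i..<j}" "e l = e 0" using assms(2) e0 by (metis imageE)
  then have "i = 0" using inj i by (auto dest!: inj_onD)
  then have X: "e ` {..<j} = X" using \<open>e ` {i..<j} = X\<close> by (simp add: lessThan_atLeast0)
  then have "card X = j" using card_image[OF inj] by simp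
  then show "inj_on (\<lambda>j. (f ^^ j) x) {..<card X}" "(\<lambda>j. (f ^^ j) x) ` {..<card X} = X"
    "(f ^^ card X) x = x"
    using inj X i \<open>i = 0\<close> e0 by (auto simp: e_def[abs_def])
qed

lemma cyclic_map_conj:
  assumes "cyclic_map X f" "bij_betw h X Y" "\<And>x. x \<in> X \<Longrightarrow> g (h x) = h (f x)"
  shows "cyclic_map Y g"
proof -
  have Y: "Y = h ` X" using assms(2) by (simp add: bij_betw_def)
  show ?thesis unfolding Y
  proof (rule cyclic_mapI)
    fix A assume A: "A \<subseteq> h ` X" "A \<noteq> {}" "\<And>x. x \<in> A \<Longrightarrow> g x \<in> A"
    have "{x \<in> X. h x \<in> A} = X"
      using A assms(1,3)
      by (intro cyclic_map_minimal[OF assms(1)]) (auto intro: cyclic_map_closed, metis)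
    then show "h ` X \<subseteq> A" by auto
  qed (use assms in \<open>auto simp: cyclic_map_def\<close>)
qed

text \<open>Induction on the set: a new point \<open>x\<close> is inserted into the arc from
  \<open>y\<close> to \<open>f y\<close>.\<close>

lemma cyclic_map_exists:
  assumes "finite X" "X \<noteq> {}"
  shows "\<exists>f. cyclic_map X f"
  using assms
proof (induct rule: finite_ne_induct)
  case (singleton x)
  have "cyclic_map {x} id" by (rule cyclic_mapI) auto
  then show ?case by blast
next
  case (insert x F)
  then obtain f y where f: "cyclic_map F f" and y: "y \<in> F" by blast
  define f' where "f' = f(y := x, x := f y)"
  have "cyclic_map (insert x F) f'"
  proof (rule cyclic_mapI)
    fix A assume A: "A \<subseteq> insert x F" "A \<noteq> {}" "\<And>v. v \<in> A \<Longrightarrow> f' v \<in> A"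
    have xA: "x \<in> A \<Longrightarrow> f y \<in> A" using A(3)[of x] by (simp add: f'_def)
    have yA: "y \<in> A \<Longrightarrow> x \<in> A" using A(3)[of y] y insert by (auto simp: f'_def split: if_splits)
    have "A \<inter> F = F"
    proof (rule cyclic_map_minimal[OF f])
      show "A \<inter> F \<noteq> {}" using A xA y f by (auto dest: cyclic_map_closed)
      fix v assume v: "v \<in> A \<inter> F"
      then show "f v \<in> A \<inter> F"
        using A(3)[of v] xA yA f insert by (auto simp: f'_def split: if_splits dest: cyclic_map_closed)
    qed auto
    then show "insert x F \<subseteq> A" using y yA by auto
  qed (use insert f y in \<open>auto simp: f'_def dest: cyclic_map_closed\<close>)
  then show ?case by blast
qed

text \<open>Conjugating any cycle by the transposition of \<open>y\<close> and \<open>f x\<close>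
  fixes \<open>x\<close> and moves its successor to \<open>y\<close>.\<close>

lemma cyclic_map_exists_prescribed:
  assumes "finite X" "x \<in> X" "y \<in> X" "x \<noteq> y"
  shows "\<exists>f. cyclic_map X f \<and> f x = y"
proof -
  obtain f where f: "cyclic_map X f" using cyclic_map_exists assms by blast
  have "card X \<noteq> 1" using assms by (auto simp: card_1_singleton_iff)
  then have fx: "f x \<noteq> x" "f x \<in> X"
    using cyclic_map_no_fixed_point[OF f] cyclic_map_closed[OF f] assms by auto
  let ?h = "Transposition.transpose y (f x)"
  have "bij_betw ?h X X"
    using fx assms by (intro bij_betw_byWitness[where f' = ?h]) (auto simp: transpose_def)
  then have "cyclic_map X (?h \<circ> f \<circ> ?h)"
    by (rule cyclic_map_conj[OF f]) simp
  moreover have "(?h \<circ> f \<circ> ?h) x = y" using fx assms by simp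
  ultimately show ?thesis by blast
qed

text \<open>Composing with this transposition sends the predecessor of \<open>z\<close> directly to
  \<open>f z\<close>, so \<open>z\<close> is cut out of the cycle.\<close>

lemma cyclic_map_bypass:
  assumes "cyclic_map X f" "z \<in> X" "f z \<noteq> z"
  shows "cyclic_map (X - {z}) (Transposition.transpose z (f z) \<circ> f)" (is "cyclic_map _ ?g")
proof -
  have inj: "inj_on f X" using cyclic_map_bij[OF assms(1)] by (simp add: bij_betw_def)
  have g: "?g v = (if f v = z then f z else f v)" if "v \<in> X - {z}" for v
    using that inj assms(2) by (auto simp: transpose_def dest: inj_onD)
  show ?thesis
  proof (rule cyclic_mapI)
    show "finite (X - {z})" using assms cyclic_map_finite by blast
    show "X - {z} \<noteq> {}" using assms cyclic_map_closed by fastforce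
    show "?g v \<in> X - {z}" if "v \<in> X - {z}" for v
      using g[OF that] that assms by (auto dest: cyclic_map_closed)
    fix A assume A: "A \<subseteq> X - {z}" "A \<noteq> {}" "\<And>v. v \<in> A \<Longrightarrow> ?g v \<in> A"
    \<comment> \<open>The cut point \<open>z\<close> is put back exactly when its successor lies in
      \<open>A\<close>; this makes the set closed under \<open>f\<close>.\<close>
    let ?B = "A \<union> (if f z \<in> A then {z} else {})"
    have "?B = X"
    proof (rule cyclic_map_minimal[OF assms(1)])
      fix v assume v: "v \<in> ?B"
      show "f v \<in> ?B"
      proof (cases "v = z")
        case True
        then show ?thesis using v A(1) by (auto split: if_splits)
      next
        case False
        then have "v \<in> A" using v by (auto split: if_splits)
        then have "?g v \<in> A" "?g v = (if f v = z then f z else f v)"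
          using A(1,3) g by blast+
        then show ?thesis by (simp split: if_splits)
      qed
    qed (use A assms in auto)
    then show "X - {z} \<subseteq> A" by (auto split: if_splits)
  qed
qed

text \<open>Colour alternately along the orbit of \<open>x\<close>; even length makes the colours
  fit where the orbit closes up.\<close>

lemma cyclic_map_two_colouring:
  assumes "cyclic_map X f" "even (card X)" "x \<in> X"
  shows "\<exists>P. P x \<and> (\<forall>y\<in>X. P (f y) \<longleftrightarrow> \<not> P y)"
proof -
  note enum = cyclic_map_enum[OF assms(1,3)]
  define e where "e j = (f ^^ j) x" for j
  have inj: "\<And>i j. i < card X \<Longrightarrow> j < card X \<Longrightarrow> e i = e j \<longleftrightarrow> i = j"
    using enum(1) by (auto simp: e_def dest: inj_onD)
  define P where "P y \<longleftrightarrow> (\<exists>j<card X. even j \<and> e j = y)" for y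
  have P: "P (e j) \<longleftrightarrow> even j" if "j < card X" for j
    using that inj by (auto simp: P_def)
  have pos: "card X > 0"
    using assms cyclic_map_finite card_gt_0_iff by blast
  have P0: "P x" using P[OF pos] by (simp add: e_def)
  moreover have "P (f y) \<longleftrightarrow> \<not> P y" if "y \<in> X" for y
  proof -
    obtain j where j: "j < card X" "y = e j" using enum(2) \<open>y \<in> X\<close> by (auto simp: e_def)
    have fy: "f y = e (Suc j)" by (simp add: j e_def)
    show ?thesis
    proof (cases "Suc j = card X")
      case True
      then have "f y = x" using fy enum(3) by (simp add: e_def del: funpow.simps)
      moreover have "odd j" using True assms(2) by (metis even_Suc)
      ultimately show ?thesis using P0 P j by simp
    next
      case False
      then show ?thesis using P[of "Suc j"] P[of j] j fy by simp
    qed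
  qed
  ultimately show ?thesis by blast
qed

section \<open>Latin squares with two prescribed symbols\<close>

text \<open>Halmos-Vaughan induction. If every proper nonempty subfamily has a surplus, one choice
  is made freely and costs the others at most one element. Otherwise a tight subfamily
  \<open>J\<close> is matched inside its own union and the rest outside it.\<close>

lemma hall_marriage:
  assumes "finite I" "\<And>i. i \<in> I \<Longrightarrow> finite (A i)"
    and "\<And>J. J \<subseteq> I \<Longrightarrow> card J \<le> card (\<Union>i\<in>J. A i)"
  shows "\<exists>f. inj_on f I \<and> (\<forall>i\<in>I. f i \<in> A i)"
  using assms
proof (induct "card I" arbitrary: I A rule: less_induct)
  case less
  consider "I = {}" | "I \<noteq> {}" "\<And>J. J \<subset> I \<Longrightarrow> J \<noteq> {} \<Longrightarrow> card J < card (\<Union>i\<in>J. A i)"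
    | J where "J \<subset> I" "J \<noteq> {}" "card J = card (\<Union>i\<in>J. A i)"
    using less.prems(3) by (metis le_neq_implies_less psubset_imp_subset)
  then show ?case
  proof cases
    case 1
    then show ?thesis by simp
  next
    case 2
    then obtain i where i: "i \<in> I" by blast
    have "card {i} \<le> card (A i)" using less.prems(3)[of "{i}"] i by simp
    then obtain x where x: "x \<in> A i" by fastforce
    have "\<exists>f. inj_on f (I - {i}) \<and> (\<forall>j\<in>I - {i}. f j \<in> A j - {x})"
    proof (rule less.hyps)
      show "card (I - {i}) < card I" using i less.prems(1) by (meson card_Diff1_less)
      fix J assume J: "J \<subseteq> I - {i}"
      show "card J \<le> card (\<Union>j\<in>J. A j - {x})"
      proof (cases "J = {}")
        case False
        have "J \<subset> I" using J i by auto
        then have lt: "card J < card (\<Union>j\<in>J. A j)" using 2 False by blast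
        have eq: "(\<Union>j\<in>J. A j - {x}) = (\<Union>j\<in>J. A j) - {x}" by auto
        show ?thesis unfolding eq using lt by (simp add: card_Diff_singleton_if) linarith
      qed simp
    qed (use less.prems(1,2) in auto)
    then obtain f where f: "inj_on f (I - {i})" "\<forall>j\<in>I - {i}. f j \<in> A j - {x}" by blast
    have "inj_on (f(i := x)) I" using f by (auto simp: inj_on_def)
    moreover have "\<forall>j\<in>I. (f(i := x)) j \<in> A j" using f x by auto
    ultimately show ?thesis by blast
  next
    case (3 J)
    let ?U = "\<Union>i\<in>J. A i"
    have J: "J \<subseteq> I" using 3 by blast
    then have "finite J" using less.prems(1) by (rule finite_subset)
    moreover from this have "finite ?U" using J less.prems(2) by blast
    ultimately have fin: "finite J" "finite ?U" by auto
    have "\<exists>f. inj_on f J \<and> (\<forall>j\<in>J. f j \<in> A j)"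
      using 3 less.prems fin by (intro less.hyps psubset_card_mono) auto
    then obtain f where f: "inj_on f J" "\<forall>j\<in>J. f j \<in> A j" by blast
    have "\<exists>g. inj_on g (I - J) \<and> (\<forall>j\<in>I - J. g j \<in> A j - ?U)"
    proof (rule less.hyps)
      show "card (I - J) < card I"
        using 3 less.prems(1) by (intro psubset_card_mono) auto
      fix L assume L: "L \<subseteq> I - J"
      have finL: "finite L" using L less.prems(1) finite_subset by blast
      let ?W = "\<Union>j\<in>L. A j - ?U"
      \<comment> \<open>Hall's condition for \<open>J \<union> L\<close>, with the tight
        \<open>J\<close> cancelled, gives the condition for \<open>L\<close> outside
        \<open>?U\<close>.\<close>
      have "card J + card L = card (J \<union> L)"
        using L finL fin by (intro card_Un_disjoint[symmetric]) auto
      also have "\<dots> \<le> card (\<Union>i\<in>J \<union> L. A i)"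
        using L 3 by (intro less.prems(3)) auto
      also have "(\<Union>i\<in>J \<union> L. A i) = ?U \<union> ?W" by auto
      also have "card \<dots> = card J + card ?W"
        unfolding 3(3) using L finL fin less.prems(2) by (intro card_Un_disjoint) auto
      finally show "card L \<le> card ?W" by (rule add_le_imp_le_left)
    qed (use less.prems(1,2) in auto)
    then obtain g where g: "inj_on g (I - J)" "\<forall>j\<in>I - J. g j \<in> A j - ?U" by blast
    let ?h = "\<lambda>i. if i \<in> J then f i else g i"
    have disj: "f i \<noteq> g j" if "i \<in> J" "j \<in> I - J" for i j
    proof -
      have "f i \<in> ?U" using f(2) that(1) by (intro UN_I) auto
      moreover have "g j \<notin> ?U" using bspec[OF g(2) that(2)] by simp
      ultimately show ?thesis by metis
    qed
    have "inj_on ?h I"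
    proof (rule inj_onI)
      fix i j assume "i \<in> I" "j \<in> I" "?h i = ?h j"
      then show "i = j"
        using disj[of i j] disj[of j i] inj_onD[OF f(1), of i j] inj_onD[OF g(1), of i j]
        by (simp split: if_splits)
    qed
    moreover have "\<forall>i\<in>I. ?h i \<in> A i" using f(2) g(2) by simp
    ultimately show ?thesis by blast
  qed
qed

text \<open>Double counting gives Hall's condition: the \<open>d * card J\<close> pairs leaving
  \<open>J\<close> are among the \<open>d * card ?N\<close> pairs entering its
  neighbourhood.\<close>

lemma regular_relation_perfect_matching:
  assumes "finite V" "E \<subseteq> V \<times> V" "d > 0"
    and "\<And>x. x \<in> V \<Longrightarrow> card {y. (x, y) \<in> E} = d"
    and "\<And>y. y \<in> V \<Longrightarrow> card {x. (x, y) \<in> E} = d"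
  shows "\<exists>f. bij_betw f V V \<and> (\<forall>x\<in>V. (x, f x) \<in> E)"
proof -
  have fin: "finite {y. (x, y) \<in> E}" "finite {y. (y, x) \<in> E}" for x
    using finite_subset[OF _ assms(1), of "{y. (x, y) \<in> E}"]
      finite_subset[OF _ assms(1), of "{y. (y, x) \<in> E}"] assms(2) by blast+
  have "\<exists>f. inj_on f V \<and> (\<forall>x\<in>V. f x \<in> {y. (x, y) \<in> E})"
  proof (rule hall_marriage)
    fix J assume J: "J \<subseteq> V"
    let ?N = "\<Union>x\<in>J. {y. (x, y) \<in> E}"
    have N: "?N \<subseteq> V" using assms(2) by auto
    have finJN: "finite J" "finite ?N" using J N assms(1) finite_subset by blast+
    have "d * card J = card (SIGMA x:J. {y. (x, y) \<in> E})"
      using assms(4) J fin finJN by (subst card_SigmaI) (auto simp: subset_iff)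
    also have "\<dots> \<le> card (SIGMA y:?N. {x. (x, y) \<in> E})"
      using fin finJN by (intro card_inj_on_le[of prod.swap]) (auto intro!: finite_SigmaI)
    also have "\<dots> = d * card ?N"
      using assms(5) N fin finJN by (subst card_SigmaI) (auto simp: subset_iff)
    finally show "card J \<le> card ?N" using assms(3) by simp
  qed (use assms fin in auto)
  then obtain f where f: "inj_on f V" "\<And>x. x \<in> V \<Longrightarrow> (x, f x) \<in> E" by auto
  then have "f ` V \<subseteq> V" using assms(2) by auto
  then have "bij_betw f V V"
    using f assms(1) by (simp add: bij_betw_def endo_inj_surj)
  then show ?thesis using f by blast
qed

text \<open>Removing the graph of a perfect matching lowers the degree by one on both sides.\<close>

lemma regular_relation_decomposition:
  assumes "finite V" "E \<subseteq> V \<times> V"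
    and "\<And>x. x \<in> V \<Longrightarrow> card {y. (x, y) \<in> E} = d"
    and "\<And>y. y \<in> V \<Longrightarrow> card {x. (x, y) \<in> E} = d"
  shows "\<exists>P. (\<forall>i<d. bij_betw (P i) V V) \<and> (\<forall>x\<in>V. bij_betw (\<lambda>i. P i x) {..<d} {y. (x, y) \<in> E})"
  using assms(2-)
proof (induct d arbitrary: E)
  case 0
  have "finite {y. (x, y) \<in> E}" for x
    using finite_subset[OF _ assms(1), of "{y. (x, y) \<in> E}"] 0(1) by blast
  then show ?case using 0 by (auto simp: bij_betw_def)
next
  case (Suc d)
  have fin: "finite {y. (x, y) \<in> E}" "finite {y. (y, x) \<in> E}" for x
    using finite_subset[OF _ assms(1), of "{y. (x, y) \<in> E}"]
      finite_subset[OF _ assms(1), of "{y. (y, x) \<in> E}"] Suc.prems(1) by blast+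
  obtain f where f: "bij_betw f V V" "\<And>x. x \<in> V \<Longrightarrow> (x, f x) \<in> E"
    using regular_relation_perfect_matching[OF assms(1) Suc.prems(1) _ Suc.prems(2,3)] by auto
  let ?E = "E - {(x, f x) | x. x \<in> V}"
  have out: "{y. (x, y) \<in> ?E} = {y. (x, y) \<in> E} - {f x}" if "x \<in> V" for x using that by auto
  have "card {y. (x, y) \<in> ?E} = d" if "x \<in> V" for x
    using Suc.prems(2)[OF that] f(2)[OF that] fin that by (subst out) auto
  moreover have "card {x. (x, y) \<in> ?E} = d" if "y \<in> V" for y
  proof -
    have "y \<in> f ` V" using bij_betw_imp_surj_on[OF f(1)] that by simp
    then obtain x where x: "x \<in> V" "y = f x" by (rule imageE)
    have "x' = x" if "x' \<in> V" "y = f x'" for x'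
      using that x inj_onD[OF bij_betw_imp_inj_on[OF f(1)], of x' x] by simp
    then have "{x. (x, y) \<in> ?E} = {x. (x, y) \<in> E} - {x}"
      using x by auto
    moreover have "(x, y) \<in> E" using f(2) x by simp
    ultimately show ?thesis using Suc.prems(3)[OF that] fin by simp
  qed
  ultimately obtain P where P: "\<And>i. i < d \<Longrightarrow> bij_betw (P i) V V"
    "\<And>x. x \<in> V \<Longrightarrow> bij_betw (\<lambda>i. P i x) {..<d} {y. (x, y) \<in> ?E}"
    using Suc.hyps[of ?E] Suc.prems(1) by blast
  let ?P = "P(d := f)"
  have "bij_betw (\<lambda>i. ?P i x) {..<Suc d} {y. (x, y) \<in> E}" if x: "x \<in> V" for x
  proof -
    have "bij_betw (\<lambda>i. ?P i x) {..<d} {y. (x, y) \<in> ?E}"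
      using P(2)[OF x] by (subst bij_betw_cong[where g = "\<lambda>i. P i x"]) auto
    then have "bij_betw (\<lambda>i. ?P i x) ({..<d} \<union> {d}) ({y. (x, y) \<in> ?E} \<union> {f x})"
      using x by (intro bij_betw_combine) (auto simp: bij_betw_def)
    moreover have "{y. (x, y) \<in> ?E} \<union> {f x} = {y. (x, y) \<in> E}" using x f(2) by auto
    ultimately show ?thesis by (simp add: lessThan_Suc Un_commute)
  qed
  moreover have "\<forall>i<Suc d. bij_betw (?P i) V V" using P f by (auto simp: less_Suc_eq)
  ultimately show ?case by blast
qed

text \<open>The identity and \<open>\<delta>\<close> form two lines; the pairs avoiding both are a
  regular relation of degree \<open>card V - 2\<close>, whose perfect matchings supply the other
  lines. The normalisation \<open>p r r = z\<close> fits the two given lines, since the identity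
  takes the value \<open>z\<close> at \<open>z\<close> and \<open>\<delta>\<close> takes it at
  \<open>c\<close>.\<close>

lemma latin_square_exists:
  assumes "finite V" "z \<in> V" "bij_betw \<delta> V V" "\<And>v. v \<in> V \<Longrightarrow> \<delta> v \<noteq> v" "c \<in> V" "\<delta> c = z"
  shows "\<exists>p. (\<forall>r\<in>V. bij_betw (p r) V V) \<and> (\<forall>k\<in>V. bij_betw (\<lambda>r. p r k) V V) \<and>
    (\<forall>r\<in>V. p r r = z) \<and> (\<forall>k\<in>V. p z k = k) \<and> (\<forall>k\<in>V. p c k = \<delta> k)"
proof -
  define n where "n = card V"
  define E where "E = {(x, y). x \<in> V \<and> y \<in> V \<and> y \<noteq> x \<and> y \<noteq> \<delta> x}"
  have \<delta>V: "\<And>v. v \<in> V \<Longrightarrow> \<delta> v \<in> V" using assms(3) by (auto simp: bij_betw_def)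
  have inj: "\<And>u v. u \<in> V \<Longrightarrow> v \<in> V \<Longrightarrow> \<delta> u = \<delta> v \<Longrightarrow> u = v"
    using assms(3) by (auto simp: bij_betw_def dest: inj_onD)
  have out: "{y. (x, y) \<in> E} = V - {x, \<delta> x}" if "x \<in> V" for x using that by (auto simp: E_def)
  have "card {y. (x, y) \<in> E} = n - 2" if "x \<in> V" for x
    unfolding out[OF that] n_def using that \<delta>V assms(1) assms(4)[OF that]
    by (subst card_Diff_subset) (auto simp: card_insert_if)
  moreover have "card {x. (x, y) \<in> E} = n - 2" if y: "y \<in> V" for y
  proof -
    obtain x where x: "x \<in> V" "y = \<delta> x"
      using y bij_betw_imp_surj_on[OF assms(3)] by blast
    then have "{x. (x, y) \<in> E} = V - {x, y}" using that inj by (auto simp: E_def)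
    moreover have "x \<noteq> y" using assms(4) x by metis
    ultimately show ?thesis
      unfolding n_def using x that assms(1) by (auto simp: card_Diff_subset card_insert_if)
  qed
  moreover have "E \<subseteq> V \<times> V" by (auto simp: E_def)
  ultimately obtain P where P: "\<And>i. i < n - 2 \<Longrightarrow> bij_betw (P i) V V"
    "\<And>x. x \<in> V \<Longrightarrow> bij_betw (\<lambda>i. P i x) {..<n - 2} {y. (x, y) \<in> E}"
    using regular_relation_decomposition[OF assms(1), of E "n - 2"] by blast
  define Q where "Q i = (if i = n - 2 then id else if i = n - 1 then \<delta> else P i)" for i
  \<comment> \<open>As \<open>\<delta>\<close> has no fixed point, \<open>z\<close> and
    \<open>c\<close> differ; so \<open>n \<ge> 2\<close> and the truncated subtractions
    \<open>n - 2\<close> and \<open>n - 1\<close> are genuine, distinct indices.\<close>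
  have "card {z, c} \<le> n" unfolding n_def using assms by (intro card_mono) auto
  then have n2: "n \<ge> 2" using assms by (cases "z = c") auto
  then have n: "{..<n} = {..<n - 2} \<union> {n - 2, n - 1}" "n - 1 \<noteq> n - 2" by auto
  have Qb: "bij_betw (Q i) V V" if "i < n" for i
    using that P(1)[of i] assms(3) n n2 by (auto simp: Q_def)
  have Qx: "bij_betw (\<lambda>i. Q i x) {..<n} V" if x: "x \<in> V" for x
  proof -
    have "bij_betw (\<lambda>i. Q i x) {..<n - 2} {y. (x, y) \<in> E}"
      using P(2)[OF x] by (subst bij_betw_cong[where g = "\<lambda>i. P i x"]) (auto simp: Q_def)
    moreover have "bij_betw (\<lambda>i. Q i x) {n - 2, n - 1} {x, \<delta> x}"
      using assms(4)[OF x] n by (auto simp: bij_betw_def Q_def)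
    ultimately have "bij_betw (\<lambda>i. Q i x) ({..<n - 2} \<union> {n - 2, n - 1}) ({y. (x, y) \<in> E} \<union> {x, \<delta> x})"
      using x by (intro bij_betw_combine) (auto simp: E_def)
    moreover have "{y. (x, y) \<in> E} \<union> {x, \<delta> x} = V" using x out \<delta>V by auto
    ultimately show ?thesis using n by simp
  qed
  \<comment> \<open>A line is named after the row in which it takes the value \<open>z\<close>.\<close>
  define line where "line r = inv_into {..<n} (\<lambda>i. Q i r) z" for r
  have line: "line r < n" "Q (line r) r = z" if "r \<in> V" for r
    using Qx[OF that] assms(2) inv_into_into[of z "\<lambda>i. Q i r" "{..<n}"]
      f_inv_into_f[of z "\<lambda>i. Q i r" "{..<n}"]
    by (auto simp: line_def bij_betw_def)
  have line_eq: "line r = i" if "r \<in> V" "i < n" "Q i r = z" for r i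
    using Qx[OF that(1)] line[OF that(1)] that by (auto simp: bij_betw_def dest: inj_onD)
  have bij_line: "bij_betw line V {..<n}"
  proof (intro bij_betw_imageI inj_onI)
    show "r = r'" if "r \<in> V" "r' \<in> V" "line r = line r'" for r r'
      using Qb[of "line r"] line that by (metis bij_betw_imp_inj_on inj_onD)
    show "line ` V = {..<n}"
    proof (intro equalityI subsetI)
      fix i assume i: "i \<in> {..<n}"
      then have "z \<in> Q i ` V" using bij_betw_imp_surj_on[OF Qb[of i]] assms(2) by simp
      then obtain r where "r \<in> V" "Q i r = z" by blast
      then show "i \<in> line ` V" using line_eq i by force
    qed (use line in auto)
  qed
  have "bij_betw (\<lambda>r. Q (line r) k) V V" if "k \<in> V" for k
    using bij_betw_trans[OF bij_line Qx[OF that]] by (simp add: comp_def)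
  moreover have "line z = n - 2" using line_eq[of z "n - 2"] assms(2) n2 by (simp add: Q_def)
  moreover have "line c = n - 1"
    using line_eq[of c "n - 1"] assms(5,6) n n2 by (simp add: Q_def)
  ultimately show ?thesis
    using Qb line n by (intro exI[of _ "\<lambda>r. Q (line r)"]) (auto simp: Q_def)
qed

section \<open>Cyclic maps on stacked copies of a set\<close>

text \<open>Steps lead from layer \<open>g\<close> to layer \<open>f g\<close>, alternately by
  \<open>a\<close> and its inverse \<open>b\<close>, with \<open>\<beta>\<close> on the step into
  \<open>g0\<close>. The intermediate maps cancel, so the first return to layer \<open>g0\<close> is
  \<open>\<beta> \<circ> a\<close>; a single orbit there gives a single orbit on all layers.\<close>

lemma cyclic_map_layers:
  assumes f: "cyclic_map I f" and g0: "g0 \<in> I" "par g0"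
    and par: "\<And>g. g \<in> I \<Longrightarrow> par (f g) \<longleftrightarrow> \<not> par g"
    and V: "finite V" "V \<noteq> {}"
    and a: "\<And>v. v \<in> V \<Longrightarrow> a v \<in> V" and b: "\<And>v. v \<in> V \<Longrightarrow> b v \<in> V"
    and ba: "\<And>v. v \<in> V \<Longrightarrow> b (a v) = v" and ab: "\<And>v. v \<in> V \<Longrightarrow> a (b v) = v"
    and \<beta>: "\<And>v. v \<in> V \<Longrightarrow> \<beta> v \<in> V" and cyc: "cyclic_map V (\<beta> \<circ> a)"
    and T: "\<And>g v. g \<in> I \<Longrightarrow> v \<in> V \<Longrightarrow>
      T (g, v) = (f g, if par g then a v else if f g = g0 then \<beta> v else b v)"
  shows "cyclic_map (I \<times> V) T"
proof (rule cyclic_mapI)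
  show "finite (I \<times> V)" "I \<times> V \<noteq> {}"
    using V cyclic_map_finite[OF f] cyclic_map_nonempty[OF f] by auto
  show "T x \<in> I \<times> V" if "x \<in> I \<times> V" for x
    using that T a b \<beta> cyclic_map_closed[OF f] by (cases x) auto
  fix A assume A: "A \<subseteq> I \<times> V" "A \<noteq> {}" "\<And>x. x \<in> A \<Longrightarrow> T x \<in> A"
  have T_A: "(f g, if par g then a v else if f g = g0 then \<beta> v else b v) \<in> A" if "(g, v) \<in> A" for g v
    using A(1) A(3)[OF that] T that by auto
  obtain g v where gv: "(g, v) \<in> A" using A(2) by auto
  then have "g \<in> I" using A(1) by auto
  have ne: "\<exists>v. (g0, v) \<in> A"
    using f \<open>g \<in> I\<close> g0(1) by (induct g0 rule: cyclic_map_induct) (use gv T_A in blast)+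
  \<comment> \<open>An orbit leaving layer \<open>g0\<close> at \<open>v\<close> shows
    \<open>v\<close> in the layers where \<open>par\<close> holds and \<open>a v\<close> in the
    others.\<close>
  have layer: "(g, if par g then v else a v) \<in> A" if v: "(g0, v) \<in> A" and g: "g \<in> I" for g v
    using f g0(1) g
  proof (induct g rule: cyclic_map_induct)
    case base
    then show ?case using v g0 by simp
  next
    case (step h)
    have "v \<in> V" using v A(1) by auto
    then show ?case
      using T_A[OF step(2)] step(1) ba par[of h] v g0(2) by (cases "f h = g0") (auto split: if_splits)
  qed
  obtain l where l: "l \<in> I" "f l = g0" using cyclic_map_preimage[OF f g0(1)] .
  have npl: "\<not> par l" using par[OF l(1)] l g0 by simp
  have "{v. (g0, v) \<in> A} = V"
  proof (rule cyclic_map_minimal[OF cyc])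
    fix v assume "v \<in> {v. (g0, v) \<in> A}"
    then show "(\<beta> \<circ> a) v \<in> {v. (g0, v) \<in> A}"
      using T_A[OF layer[of v l]] l npl by simp
  qed (use A ne in auto)
  then have "(g, if par g then v else a v) \<in> A" if "g \<in> I" "v \<in> V" for g v
    using layer that by blast
  \<comment> \<open>In a layer where \<open>par\<close> fails, the point \<open>w\<close> is hit by
    the orbit of \<open>b w\<close>.\<close>
  from this[of _ "b _"] this show "I \<times> V \<subseteq> A"
    using ab b by (auto split: if_splits) metis
qed

text \<open>Since \<open>z\<close> now leads to \<open>k\<close> in its own layer, and
  \<open>a\<close> and \<open>b\<close> exchange \<open>z\<close> and \<open>k\<close>, no layer is
  entered at \<open>k\<close>. An orbit entering a layer at \<open>z\<close> leaves it from
  \<open>k\<close> and, before the closing step, enters the next one at \<open>z\<close> again. So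
  the return map on the entry points \<open>V - {k}\<close> of layer \<open>g0\<close> is again
  \<open>\<beta> \<circ> a\<close>.\<close>

lemma cyclic_map_layers_bypass:
  assumes f: "cyclic_map I f" and g0: "g0 \<in> I" "par g0"
    and par: "\<And>g. g \<in> I \<Longrightarrow> par (f g) \<longleftrightarrow> \<not> par g"
    and V: "finite V" "z \<in> V" "k \<in> V" "z \<noteq> k"
    and a: "\<And>v. v \<in> V \<Longrightarrow> a v \<in> V" and b: "\<And>v. v \<in> V \<Longrightarrow> b v \<in> V"
    and ba: "\<And>v. v \<in> V \<Longrightarrow> b (a v) = v" and ab: "\<And>v. v \<in> V \<Longrightarrow> a (b v) = v"
    and az: "a z = k" and ak: "a k = z"
    and \<beta>: "\<And>v. v \<in> V \<Longrightarrow> \<beta> v \<in> V" and cyc: "cyclic_map (V - {k}) (\<beta> \<circ> a)"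
    and T: "\<And>g v. g \<in> I \<Longrightarrow> v \<in> V \<Longrightarrow> T (g, v) = (if v = z then (g, k)
      else (f g, if par g then a v else if f g = g0 then \<beta> v else b v))"
  shows "cyclic_map (I \<times> V) T"
proof (rule cyclic_mapI)
  show "finite (I \<times> V)" "I \<times> V \<noteq> {}"
    using V cyclic_map_finite[OF f] cyclic_map_nonempty[OF f] by auto
  show "T x \<in> I \<times> V" if "x \<in> I \<times> V" for x
    using that T a b \<beta> V cyclic_map_closed[OF f] by (cases x) auto
  have bz: "b z = k" and bk: "b k = z" using ba[of k] ba[of z] ak az V by auto
  have R: "\<beta> (a v) \<in> V" "\<beta> (a v) \<noteq> k" if "v \<in> V" "v \<noteq> k" for v
    using cyclic_map_closed[OF cyc, of v] that by auto
  fix A assume A: "A \<subseteq> I \<times> V" "A \<noteq> {}" "\<And>x. x \<in> A \<Longrightarrow> T x \<in> A"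
  have T_z: "(g, k) \<in> A" if "(g, z) \<in> A" for g
    using A(1) A(3)[OF that] T that by auto
  have T_A: "(f g, if par g then a v else if f g = g0 then \<beta> v else b v) \<in> A"
    if "(g, v) \<in> A" "v \<noteq> z" for g v
    using A(1) A(3)[OF that(1)] T that by auto
  have entry: "\<exists>v. v \<noteq> k \<and> (f g, v) \<in> A" if "(g, v) \<in> A" "g \<in> I" for g v
  proof -
    have "\<exists>u. u \<in> V \<and> u \<noteq> z \<and> (g, u) \<in> A"
      using that T_z V A(1) by (cases "v = z") auto
    then obtain u where u: "u \<in> V" "u \<noteq> z" "(g, u) \<in> A" by blast
    have "a u \<noteq> k" using ba[OF u(1)] bk u by auto
    moreover have "b u \<noteq> k" using ab[OF u(1)] ak u by auto
    moreover have "\<beta> u \<noteq> k" using R[of "b u"] ab[OF u(1)] b[OF u(1)] \<open>b u \<noteq> k\<close> by simp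
    ultimately show ?thesis
      using T_A[OF u(3,2)] by metis
  qed
  obtain g v where gv: "(g, v) \<in> A" using A(2) by auto
  then have g: "g \<in> I" using A(1) by auto
  \<comment> \<open>The walk starts at layer \<open>f g\<close>, because the known point of
    \<open>A\<close> in layer \<open>g\<close> may be \<open>k\<close> itself.\<close>
  have fg: "f g \<in> I" using cyclic_map_closed[OF f g] .
  have ne: "\<exists>v. v \<noteq> k \<and> (g0, v) \<in> A"
    using f fg g0(1) by (induct g0 rule: cyclic_map_induct) (use entry gv g in blast)+
  \<comment> \<open>This is the entry point into a layer without \<open>par\<close>, for an orbit
    that entered layer \<open>g0\<close> at \<open>v\<close>.\<close>
  define a' where "a' v = (if v = z then z else a v)" for v
  have layer: "(g, if par g then v else a' v) \<in> A" if v: "(g0, v) \<in> A" "v \<noteq> k" and g: "g \<in> I" for g v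
    using f g0(1) g
  proof (induct g rule: cyclic_map_induct)
    case base
    then show ?case using v g0 by simp
  next
    case (step h)
    have vV: "v \<in> V" using v A(1) by auto
    have av: "a v \<noteq> z" using ba[OF vV] bz v(2) by auto
    show ?case
    proof (cases "f h = g0")
      case True
      then show ?thesis using v g0 by simp
    next
      case False
      show ?thesis
      proof (cases "v = z")
        case True
        then have "(h, k) \<in> A" using step(2) T_z by (simp add: a'_def split: if_splits)
        then show ?thesis
          using T_A[of h k] False V ak bk par[OF step(1)] True by (auto simp: a'_def)
      next
        case vz: False
        then have "(h, if par h then v else a v) \<in> A"
          using step(2) by (simp add: a'_def split: if_splits)
        then show ?thesis
          using T_A[of h "if par h then v else a v"] False par[OF step(1)] vz av ba[OF vV]
          by (auto simp: a'_def split: if_splits)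
      qed
    qed
  qed
  obtain l where l: "l \<in> I" "f l = g0" using cyclic_map_preimage[OF f g0(1)] .
  have npl: "\<not> par l" using par[OF l(1)] l g0 by simp
  have "{v. v \<noteq> k \<and> (g0, v) \<in> A} = V - {k}"
  proof (rule cyclic_map_minimal[OF cyc])
    fix v assume "v \<in> {v. v \<noteq> k \<and> (g0, v) \<in> A}"
    then have v: "v \<noteq> k" "(g0, v) \<in> A" "v \<in> V" using A(1) by auto
    have av: "a v \<noteq> z" using ba[OF v(3)] bz v(1) by auto
    have "(l, a' v) \<in> A" using layer[OF v(2,1) l(1)] npl by simp
    then have "(l, a v) \<in> A" using T_z[of l] az by (auto simp: a'_def split: if_splits)
    then have "(g0, \<beta> (a v)) \<in> A" using T_A[OF _ av] l npl by force
    then show "(\<beta> \<circ> a) v \<in> {v. v \<noteq> k \<and> (g0, v) \<in> A}" using R v by simp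
  qed (use A ne in auto)
  then have entries: "(g, if par g then v else a' v) \<in> A" if "g \<in> I" "v \<in> V" "v \<noteq> k" for g v
    using layer that by blast
  \<comment> \<open>Every point except \<open>k\<close> is an entry point of its layer;
    \<open>k\<close> is then reached from \<open>z\<close>.\<close>
  have main: "(g, w) \<in> A" if g: "g \<in> I" and w: "w \<in> V" "w \<noteq> k" for g w
  proof (cases "par g \<or> w = z")
    case True
    then show ?thesis using entries[OF g w] by (auto simp: a'_def split: if_splits)
  next
    case False
    have "b w \<noteq> k" "b w \<noteq> z" using ab[OF w(1)] ak az w(2) False by auto
    then show ?thesis using entries[OF g b[OF w(1)]] False ab[OF w(1)] by (simp add: a'_def)
  qed
  show "I \<times> V \<subseteq> A"
  proof (clarify)
    fix g w assume "g \<in> I" "w \<in> V"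
    then show "(g, w) \<in> A" using main[of g w] T_z[OF main[of g z]] V by (cases "w = k") auto
  qed
qed

text \<open>A copy is left only at \<open>z\<close> and entered only at \<open>d z\<close>, the
  successor of \<open>z\<close>, so each visit runs once around the cycle \<open>d\<close>.\<close>

lemma cyclic_map_spliced_copies:
  assumes f: "cyclic_map I f" and d: "cyclic_map V d" and z: "z \<in> V"
    and T: "\<And>g v. g \<in> I \<Longrightarrow> v \<in> V \<Longrightarrow> T (g, v) = (if v = z then (f g, d z) else (g, d v))"
  shows "cyclic_map (I \<times> V) T"
proof (rule cyclic_mapI)
  show "finite (I \<times> V)" "I \<times> V \<noteq> {}"
    using cyclic_map_finite[OF f] cyclic_map_finite[OF d] cyclic_map_nonempty[OF f] z by auto
  show "T x \<in> I \<times> V" if "x \<in> I \<times> V" for x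
    using that T z cyclic_map_closed[OF f] cyclic_map_closed[OF d] by (cases x) auto
  fix A assume A: "A \<subseteq> I \<times> V" "A \<noteq> {}" "\<And>x. x \<in> A \<Longrightarrow> T x \<in> A"
  have T_A: "if v = z then (f g, d z) \<in> A else (g, d v) \<in> A" if "(g, v) \<in> A" for g v
    using A(1) A(3)[OF that] T that by auto
  have exit: "(g, z) \<in> A" if "(g, v) \<in> A" for g v
  proof -
    have "v \<in> V" using that A(1) by auto
    show "(g, z) \<in> A"
    proof (rule ccontr)
      assume z': "(g, z) \<notin> A"
      have "(g, z) \<in> A"
        using d \<open>v \<in> V\<close> z
      proof (induct z rule: cyclic_map_induct)
        case (step w)
        then show ?case using T_A[of g w] z' by (auto split: if_splits)
      qed (rule that)
      then show False using z' by contradiction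
    qed
  qed
  obtain h v where h: "(h, v) \<in> A" using A(2) by auto
  then have "h \<in> I" using A(1) by auto
  have exits: "(g, z) \<in> A" if "g \<in> I" for g
    using f \<open>h \<in> I\<close> that
  proof (induct g rule: cyclic_map_induct)
    case base
    then show ?case using exit h by blast
  next
    case (step g)
    then show ?case using T_A[of g z] exit by auto
  qed
  show "I \<times> V \<subseteq> A"
  proof (clarify)
    fix g w assume g: "g \<in> I" and w: "w \<in> V"
    obtain l where l: "l \<in> I" "f l = g" using cyclic_map_preimage[OF f g] .
    have start: "(g, d z) \<in> A" using T_A[OF exits[OF l(1)]] l by simp
    show "(g, w) \<in> A"
      using d cyclic_map_closed[OF d z] w
    proof (induct w rule: cyclic_map_induct)
      \<comment> \<open>At \<open>v = z\<close> the orbit leaves the copy, but the point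
        \<open>d z\<close> required there is the start.\<close>
      case (step v)
      then show ?case using T_A[of g v] start by (auto split: if_splits)
    qed (rule start)
  qed
qed

section \<open>Directed cycles as cyclic maps\<close>

lemma pawalk_verts_eq: "pcas u p v \<Longrightarrow> pawalk_verts u p = u # map snd p"
  by (induct p arbitrary: u) auto

lemma map_fst_pcas: "pcas u p v \<Longrightarrow> map fst p @ [v] = u # map snd p"
  by (induct p arbitrary: u) auto

lemma pcas_appendD: "pcas u (p @ q) v \<Longrightarrow> \<exists>w. pcas u p w \<and> pcas w q v"
  by (induct p arbitrary: u) auto

lemma pcas_invariant:
  assumes "pcas u p v" "u \<in> A" "\<And>x y. (x, y) \<in> set p \<Longrightarrow> x \<in> A \<Longrightarrow> y \<in> A"
  shows "v \<in> A" "fst ` set p \<subseteq> A"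
  using assms by (induct p arbitrary: u) force+

lemma pcas_iterates:
  "pcas (e i) (map (\<lambda>j. (e j, e (Suc j))) [i..<i + k]) (e (i + k))"
proof (induct k arbitrary: i)
  case (Suc k)
  have "[i..<i + Suc k] = i # [Suc i..<Suc i + k]" by (simp add: upt_conv_Cons del: upt_Suc)
  then show ?case using Suc[of "Suc i"] by (simp del: upt_Suc)
qed simp

text \<open>Tails and heads of a closed walk form the same multiset, so distinct heads force
  distinct tails and the arcs are the graph of a function. Conversely, the iterates from any vertex
  spell out the walk.\<close>

lemma directed_cycle_iff:
  "directed_cycle D \<longleftrightarrow>
    pair_digraph D \<and> (\<exists>f. cyclic_map (pverts D) f \<and> parcs D = (\<lambda>x. (x, f x)) ` pverts D)"
proof (intro iffI conjI; (elim conjE exE)?)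
  assume "directed_cycle D"
  then obtain p u where D: "pair_digraph D" and p: "pcas u p u" "distinct (tl (pawalk_verts u p))" "p \<noteq> []"
    and parcs: "parcs D = set p" and pverts: "pverts D = fst ` set p"
    unfolding directed_cycle_def pre_digraph.cycle_def pre_digraph.awalk_def
      cas_with_proj_eq awalk_verts_with_proj_eq by blast
  show "pair_digraph D" by fact
  have eq: "map fst p @ [u] = u # map snd p" using map_fst_pcas[OF p(1)] .
  have "mset (map fst p @ [u]) = mset (u # map snd p)" unfolding eq ..
  then have mset: "mset (map fst p) = mset (map snd p)" by simp
  have "distinct (map snd p)" using p(2) pawalk_verts_eq[OF p(1)] by simp
  then have dist: "distinct (map fst p)" using mset_eq_imp_distinct_iff[OF mset] by simp
  have sets: "snd ` set p = fst ` set p" using mset_eq_setD[OF mset] by simp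
  \<comment> \<open>The arc list doubles as an association list from tails to heads; values off the
    cycle are irrelevant.\<close>
  define f where "f x = the (map_of p x)" for x
  have f: "f x = y" if "(x, y) \<in> set p" for x y
    using that dist by (simp add: f_def)
  have "cyclic_map (pverts D) f"
  proof (rule cyclic_mapI)
    show "finite (pverts D)" "pverts D \<noteq> {}" using pverts p(3) by auto
    show "f x \<in> pverts D" if "x \<in> pverts D" for x
    proof -
      have "\<exists>y. (x, y) \<in> set p" using that pverts by auto
      then show ?thesis using f sets pverts by force
    qed
    fix A assume A: "A \<subseteq> pverts D" "A \<noteq> {}" "\<And>x. x \<in> A \<Longrightarrow> f x \<in> A"
    have inv: "y \<in> A" if "(x, y) \<in> set p" "x \<in> A" for x y using A(3)[OF that(2)] f[OF that(1)] by simp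
    \<comment> \<open>From a tail in \<open>A\<close> the walk runs on to its base point
      \<open>u\<close>, and from \<open>u\<close> it visits every tail.\<close>
    obtain a where "a \<in> A" "a \<in> fst ` set p" using A(1,2) pverts by blast
    then obtain b q r where "a \<in> A" and p_eq: "p = q @ (a, b) # r" by (auto dest!: split_list)
    then have "pcas a ((a, b) # r) u" using pcas_appendD[of u q "(a, b) # r" u] p(1) by auto
    then have "u \<in> A" using \<open>a \<in> A\<close> inv p_eq by (intro pcas_invariant(1)[of a "(a, b) # r" u A]) auto
    then show "pverts D \<subseteq> A"
      unfolding pverts using inv by (rule pcas_invariant(2)[OF p(1)])
  qed
  moreover have "parcs D = (\<lambda>x. (x, f x)) ` pverts D"
    unfolding parcs pverts using f by (force simp: image_iff)
  ultimately show "\<exists>f. cyclic_map (pverts D) f \<and> parcs D = (\<lambda>x. (x, f x)) ` pverts D" by blast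
next
  fix f assume D: "pair_digraph D" and f: "cyclic_map (pverts D) f"
    and parcs: "parcs D = (\<lambda>x. (x, f x)) ` pverts D"
  obtain x where x: "x \<in> pverts D" using cyclic_map_nonempty[OF f] by blast
  define n where "n = card (pverts D)"
  define e where "e j = (f ^^ j) x" for j
  define p where "p = map (\<lambda>j. (e j, e (Suc j))) [0..<n]"
  note enum = cyclic_map_enum[OF f x, folded n_def e_def]
  have "n > 0" using x cyclic_map_finite[OF f] by (auto simp: n_def card_gt_0_iff)
  have e: "e (Suc j) = f (e j)" for j by (simp add: e_def)
  have p: "pcas x p x" using pcas_iterates[of e 0 n] enum(3) by (simp add: p_def e_def)
  have "set p = (\<lambda>j. (e j, f (e j))) ` {..<n}" by (auto simp: p_def e)
  also have "\<dots> = (\<lambda>x. (x, f x)) ` (\<lambda>j. e j) ` {..<n}" by auto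
  finally have set_p: "set p = parcs D" using enum(2) parcs by simp
  have "inj_on (f \<circ> e) {..<n}"
    using enum cyclic_map_bij[OF f] by (intro comp_inj_on) (auto simp: bij_betw_def)
  then have "distinct (map snd p)"
    by (simp add: p_def comp_def distinct_map e lessThan_atLeast0)
  then have "distinct (tl (pawalk_verts x p))" using pawalk_verts_eq[OF p] by simp
  moreover have "p \<noteq> []" using \<open>n > 0\<close> by (simp add: p_def)
  moreover have "pverts D = fst ` set p" unfolding set_p parcs by force
  ultimately show "directed_cycle D"
    unfolding directed_cycle_def pre_digraph.cycle_def pre_digraph.awalk_def
      cas_with_proj_eq awalk_verts_with_proj_eq
    using D p x set_p by (auto intro!: exI[of _ p] exI[of _ x])
qed

section \<open>Hamiltonian decompositions as families of cyclic maps\<close>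

lemma hamiltonian_cycleE:
  assumes "hamiltonian_cycle D C"
  obtains f where "cyclic_map (pverts D) f" "parcs C = (\<lambda>x. (x, f x)) ` pverts D"
  using assms unfolding hamiltonian_cycle_def spanning_def directed_cycle_iff by auto

lemma hamiltonian_decomposable_cyclic_maps:
  assumes "hamiltonian_decomposable D"
  obtains F where "F \<noteq> {}" "\<And>f. f \<in> F \<Longrightarrow> cyclic_map (pverts D) f"
    "\<And>f g x. f \<in> F \<Longrightarrow> g \<in> F \<Longrightarrow> x \<in> pverts D \<Longrightarrow> f x = g x \<Longrightarrow> f = g"
    "parcs D = {(x, f x) | x f. x \<in> pverts D \<and> f \<in> F}"
proof -
  obtain \<C> where \<C>: "decomposition D \<C>" "\<C> \<noteq> {}" "\<And>C. C \<in> \<C> \<Longrightarrow> hamiltonian_cycle D C"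
    using assms unfolding hamiltonian_decomposable_def hamiltonian_decomposition_def by blast
  then have "\<forall>C\<in>\<C>. \<exists>f. cyclic_map (pverts D) f \<and> parcs C = (\<lambda>x. (x, f x)) ` pverts D"
    by (metis hamiltonian_cycleE)
  then obtain s where s: "\<And>C. C \<in> \<C> \<Longrightarrow> cyclic_map (pverts D) (s C)"
    "\<And>C. C \<in> \<C> \<Longrightarrow> parcs C = (\<lambda>x. (x, s C x)) ` pverts D" by metis
  have disj: "C = C'" if "C \<in> \<C>" "C' \<in> \<C>" "x \<in> pverts D" "s C x = s C' x" for C C' x
  proof (rule ccontr)
    assume "C \<noteq> C'"
    then have "parcs C \<inter> parcs C' = {}"
      using \<C>(1) that by (auto simp: decomposition_def pairwise_def)
    then show False using s(2)[OF that(1)] s(2)[OF that(2)] that(3,4) by force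
  qed
  have "parcs D = (\<Union>C\<in>\<C>. parcs C)" using \<C>(1) by (simp add: decomposition_def)
  also have "\<dots> = {(x, f x) | x f. x \<in> pverts D \<and> f \<in> s ` \<C>}" using s(2) by fastforce
  finally have parcs: "parcs D = {(x, f x) | x f. x \<in> pverts D \<and> f \<in> s ` \<C>}" .
  show thesis
  proof (rule that[OF _ _ _ parcs])
    show "f = g" if "f \<in> s ` \<C>" "g \<in> s ` \<C>" "x \<in> pverts D" "f x = g x" for f g x
      using that disj by blast
  qed (use \<C>(2) s(1) in auto)
qed

text \<open>Arc-disjointness is stated pointwise on the maps, and an arbitrary index set allows
  cycles of different origin to be listed in one disjoint sum.\<close>

lemma hamiltonian_decomposableI:
  assumes D: "pair_digraph D" and I: "I \<noteq> {}"
    and T: "\<And>i. i \<in> I \<Longrightarrow> cyclic_map (pverts D) (T i)"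
    and disj: "\<And>i j x. i \<in> I \<Longrightarrow> j \<in> I \<Longrightarrow> x \<in> pverts D \<Longrightarrow> T i x = T j x \<Longrightarrow> i = j"
    and parcs: "parcs D = {(x, T i x) | x i. x \<in> pverts D \<and> i \<in> I}"
  shows "hamiltonian_decomposable D"
proof -
  interpret D: pair_digraph D by fact
  define C where "C i = \<lparr>pverts = pverts D, parcs = (\<lambda>x. (x, T i x)) ` pverts D\<rparr>" for i
  have C: "pverts (C i) = pverts D" "parcs (C i) = (\<lambda>x. (x, T i x)) ` pverts D" for i
    by (auto simp: C_def)
  have sub: "parcs (C i) \<subseteq> parcs D" if "i \<in> I" for i using that by (auto simp: C parcs)
  have pd: "pair_digraph (C i)" if "i \<in> I" for i
  proof
    show "finite (pverts (C i))" "finite (parcs (C i))" by (auto simp: C D.pair_finite_verts)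
    fix e assume "e \<in> parcs (C i)"
    then have "e \<in> parcs D" using sub[OF that] by blast
    then show "fst e \<in> pverts (C i)" "snd e \<in> pverts (C i)" "fst e \<noteq> snd e"
      using D.arc_fst_in_verts D.arc_snd_in_verts D.pair_no_loops by (auto simp: C)
  qed
  have span: "spanning (with_proj (C i)) (with_proj D)" if "i \<in> I" for i
  proof -
    interpret Ci: pair_digraph "C i" using pd[OF that] .
    show ?thesis
      using sub[OF that] D.wf_digraph_axioms Ci.wf_digraph_axioms
      by (auto simp: spanning_def subgraph_def compatible_def C)
  qed
  have "hamiltonian_cycle D (C i)" if "i \<in> I" for i
    unfolding hamiltonian_cycle_def directed_cycle_iff
    using span[OF that] pd[OF that] T[OF that] by (auto simp: C)
  moreover have "decomposition D (C ` I)"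
    unfolding decomposition_def
  proof (intro conjI)
    show "\<forall>C'\<in>C ` I. subgraph (with_proj C') (with_proj D)" using span by (auto simp: spanning_def)
    show "pairwise (\<lambda>C C'. parcs C \<inter> parcs C' = {}) (C ` I)"
      using disj by (auto simp: pairwise_def C)
    show "(\<Union>C'\<in>C ` I. parcs C') = parcs D" by (auto simp: C parcs)
  qed
  ultimately show ?thesis
    unfolding hamiltonian_decomposable_def hamiltonian_decomposition_def using I by blast
qed

section \<open>Wreath products\<close>

lemma bij_betw_latin_columnI:
  assumes "finite V" "\<And>k. k \<in> V \<Longrightarrow> h k \<in> V"
    and "\<And>k k'. k \<in> V \<Longrightarrow> k' \<in> V \<Longrightarrow> h k = h k' \<Longrightarrow> k = k'"
  shows "bij_betw h V V"
  using assms by (intro bij_betw_imageI endo_inj_surj) (auto intro: inj_onI)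

text \<open>
  The last layer uses \<open>\<beta>'\<close> along the cycle of \<open>G\<close> that absorbs the arcs of \<open>H\<close>, and \<open>\<beta>\<close> along
  all other cycles of \<open>G\<close>.
\<close>

locale layer_maps =
  fixes V K :: "'b set" and z :: 'b and a b \<beta> \<beta>' :: "'b \<Rightarrow> 'b \<Rightarrow> 'b"
  assumes a_column: "v \<in> V \<Longrightarrow> bij_betw (\<lambda>k. a k v) V V"
    and b_column: "v \<in> V \<Longrightarrow> bij_betw (\<lambda>k. b k v) V V"
    and \<beta>_column: "v \<in> V \<Longrightarrow> bij_betw (\<lambda>k. \<beta> k v) V V"
    and \<beta>'_column: "v \<in> V \<Longrightarrow> bij_betw (\<lambda>k. \<beta>' k v) V V"
    and a_b: "k \<in> V \<Longrightarrow> v \<in> V \<Longrightarrow> a k (b k v) = v"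
    and b_a: "k \<in> V \<Longrightarrow> v \<in> V \<Longrightarrow> b k (a k v) = v"
    and a_z: "k \<in> V \<Longrightarrow> a k z = k" and a_diag: "k \<in> V \<Longrightarrow> a k k = z"
    and \<beta>_cyclic: "k \<in> V \<Longrightarrow> cyclic_map V (\<beta> k \<circ> a k)"
    and \<beta>'_cyclic: "k \<in> V \<Longrightarrow> k \<notin> K \<Longrightarrow> cyclic_map V (\<beta>' k \<circ> a k)"
    and \<beta>'_cyclic_bypass: "k \<in> K \<Longrightarrow> cyclic_map (V - {k}) (\<beta>' k \<circ> a k)"
    and \<beta>'_z: "k \<in> K \<Longrightarrow> \<beta>' k z = k"

text \<open>Read \<open>a k v\<close> as the symbol in row \<open>k\<close> and column
  \<open>v\<close>, and \<open>b k r\<close> as the column of symbol \<open>r\<close> in row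
  \<open>k\<close>. Both \<open>K\<close> and \<open>V - K\<close> have at least two elements, so
  each carries a cycle without fixed points; \<open>\<delta>\<close> joins the two. In row
  \<open>k\<close>, symbol \<open>z\<close> stands in column \<open>k\<close> and symbol
  \<open>c\<close> in column \<open>\<delta> k\<close>.\<close>

lemma layer_maps_exist:
  assumes V: "finite V" "z \<in> V" and K: "K \<subseteq> V" "z \<notin> K" "K \<noteq> {}" "card K \<noteq> 1"
    and c: "c \<in> V" "c \<notin> K" "c \<noteq> z"
  shows "\<exists>a b \<beta> \<beta>'. layer_maps V K z a b \<beta> \<beta>'"
proof -
  obtain \<kappa> where \<kappa>: "cyclic_map K \<kappa>" using cyclic_map_exists[of K] K V finite_subset by blast
  obtain \<mu> where \<mu>: "cyclic_map (V - K) \<mu>" "\<mu> c = z"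
    using cyclic_map_exists_prescribed[of "V - K" c z] V K c by blast
  have "\<not> (\<exists>x. V - K = {x})" using V c K by (metis DiffI singletonD)
  then have cardVK: "card (V - K) \<noteq> 1" by (simp add: card_1_singleton_iff)
  define \<delta> where "\<delta> v = (if v \<in> K then \<kappa> v else \<mu> v)" for v
  have \<delta>K: "bij_betw \<delta> K K"
    using cyclic_map_bij[OF \<kappa>] by (subst bij_betw_cong[where g = \<kappa>]) (auto simp: \<delta>_def)
  have \<delta>VK: "bij_betw \<delta> (V - K) (V - K)"
    using cyclic_map_bij[OF \<mu>(1)] by (subst bij_betw_cong[where g = \<mu>]) (auto simp: \<delta>_def)
  have glue: "bij_betw h V V" if "bij_betw h K K" "bij_betw h (V - K) (V - K)" for h
  proof -
    have "bij_betw h (K \<union> (V - K)) (K \<union> (V - K))" using that by (rule bij_betw_combine) auto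
    then show ?thesis using K(1) by (simp add: Un_absorb1)
  qed
  have \<delta>: "bij_betw \<delta> V V" using \<delta>K \<delta>VK by (rule glue)
  have "\<delta> v \<noteq> v" if "v \<in> V" for v
    using cyclic_map_no_fixed_point[OF \<kappa> K(4)] cyclic_map_no_fixed_point[OF \<mu>(1) cardVK] that
    by (auto simp: \<delta>_def)
  moreover have "\<delta> c = z" using \<mu> c by (simp add: \<delta>_def)
  ultimately obtain p where p: "\<And>r. r \<in> V \<Longrightarrow> bij_betw (p r) V V"
    "\<And>k. k \<in> V \<Longrightarrow> bij_betw (\<lambda>r. p r k) V V" "\<And>r. r \<in> V \<Longrightarrow> p r r = z"
    "\<And>k. k \<in> V \<Longrightarrow> p z k = k" "\<And>k. k \<in> V \<Longrightarrow> p c k = \<delta> k"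
    using latin_square_exists[OF V \<delta> _ c(1)] by blast
  have p_inj: "k = k'" if "p r k = p r k'" "r \<in> V" "k \<in> V" "k' \<in> V" for r k k'
    using inj_onD[OF bij_betw_imp_inj_on[OF p(1)]] that by blast
  define b where "b k r = p r k" for k r
  define a where "a k = inv_into V (b k)" for k
  have bij_b: "bij_betw (b k) V V" if "k \<in> V" for k using p(2)[OF that] by (simp add: b_def[abs_def])
  have ab: "a k (b k v) = v" and ba: "b k (a k v) = v" if "k \<in> V" "v \<in> V" for k v
    using bij_betw_inv_into_left[OF bij_b[OF that(1)] that(2)]
      bij_betw_inv_into_right[OF bij_b[OF that(1)] that(2)] by (auto simp: a_def)
  have aV: "a k v \<in> V" and bV: "b k v \<in> V" if "k \<in> V" "v \<in> V" for k v
    using bij_betwE[OF bij_betw_inv_into[OF bij_b[OF that(1)]]] bij_betwE[OF bij_b[OF that(1)]] that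
    by (auto simp: a_def)
  have bz: "b k z = k" if "k \<in> V" for k using p(4)[OF that] by (simp add: b_def)
  have az: "a k z = k" if "k \<in> V" for k using ab[OF that that] p(3)[OF that] by (simp add: b_def)
  have ak: "a k k = z" if "k \<in> V" for k using ab[OF that V(2)] bz[OF that] by simp
  \<comment> \<open>With \<open>\<gamma> z = c\<close>, the exchange \<open>\<tau>\<close> turns
    \<open>\<beta>' k z\<close> into \<open>b k z = k\<close> for \<open>k\<close> in
    \<open>K\<close>.\<close>
  obtain \<gamma> where \<gamma>: "cyclic_map V \<gamma>" "\<gamma> z = c" using cyclic_map_exists_prescribed V c by metis
  define \<tau> where "\<tau> = Transposition.transpose z c"
  define \<beta> where "\<beta> k v = b k (\<gamma> v)" for k v
  define \<beta>' where "\<beta>' k v = (if k \<in> K then b k (\<tau> (\<gamma> v)) else b k (\<gamma> v))" for k v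
  have a_col: "bij_betw (\<lambda>k. a k v) V V" if "v \<in> V" for v
  proof (rule bij_betw_latin_columnI[OF V(1)])
    fix k k' assume k: "k \<in> V" "k' \<in> V" "a k v = a k' v"
    then have "p (a k v) k = p (a k v) k'" using ba[OF _ that] by (metis b_def)
    then show "k = k'" using p_inj aV k that by blast
  qed (use aV that in auto)
  have b_col: "bij_betw (\<lambda>k. b k v) V V" if "v \<in> V" for v
    using p(1)[OF that] by (simp add: b_def)
  have \<beta>_col: "bij_betw (\<lambda>k. \<beta> k v) V V" if "v \<in> V" for v
    unfolding \<beta>_def by (rule b_col[OF cyclic_map_closed[OF \<gamma>(1) that]])
  have \<beta>'_col: "bij_betw (\<lambda>k. \<beta>' k v) V V" if "v \<in> V" for v
  proof -
    have \<gamma>v: "\<gamma> v \<in> V" using cyclic_map_closed[OF \<gamma>(1) that] .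
    \<comment> \<open>The exchange only affects the columns with \<open>\<gamma> v\<close> equal to
      \<open>z\<close> or \<open>c\<close>. There one of \<open>K\<close> and \<open>V - K\<close>
      is permuted by \<open>\<delta>\<close> and the other by the identity, and the two parts
      glue.\<close>
    consider "\<gamma> v = z" | "\<gamma> v = c" | "\<gamma> v \<noteq> z" "\<gamma> v \<noteq> c" by blast
    then show ?thesis
    proof cases
      case 1
      then have eq: "\<beta>' k v = (if k \<in> K then \<delta> k else k)" if "k \<in> V" for k
        using p(4,5) that by (simp add: \<beta>'_def \<tau>_def b_def)
      show ?thesis
      proof (rule glue)
        show "bij_betw (\<lambda>k. \<beta>' k v) K K"
          using \<delta>K K(1) by (subst bij_betw_cong[where g = \<delta>]) (auto simp: eq subset_iff)
        show "bij_betw (\<lambda>k. \<beta>' k v) (V - K) (V - K)"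
          by (subst bij_betw_cong[where g = id]) (auto simp: eq)
      qed
    next
      case 2
      then have eq: "\<beta>' k v = (if k \<in> K then k else \<delta> k)" if "k \<in> V" for k
        using p(4,5) that by (simp add: \<beta>'_def \<tau>_def b_def)
      show ?thesis
      proof (rule glue)
        show "bij_betw (\<lambda>k. \<beta>' k v) K K"
          using K(1) by (subst bij_betw_cong[where g = id]) (auto simp: eq subset_iff)
        show "bij_betw (\<lambda>k. \<beta>' k v) (V - K) (V - K)"
          using \<delta>VK by (subst bij_betw_cong[where g = \<delta>]) (auto simp: eq)
      qed
    next
      case 3
      then have "\<beta>' k v = \<beta> k v" for k by (simp add: \<beta>'_def \<beta>_def \<tau>_def)
      then show ?thesis using \<beta>_col[OF that] by simp
    qed
  qed
  have cyc: "cyclic_map V (\<beta> k \<circ> a k)" if "k \<in> V" for k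
    using that ab by (intro cyclic_map_conj[OF \<gamma>(1) bij_b[OF that]]) (simp add: \<beta>_def)
  have cyc': "cyclic_map V (\<beta>' k \<circ> a k)" if "k \<in> V" "k \<notin> K" for k
    using that ab by (intro cyclic_map_conj[OF \<gamma>(1) bij_b[OF that(1)]]) (simp add: \<beta>'_def)
  have cyc_bypass: "cyclic_map (V - {k}) (\<beta>' k \<circ> a k)" if kK: "k \<in> K" for k
  proof (rule cyclic_map_conj)
    have k: "k \<in> V" using kK K(1) by blast
    show "cyclic_map (V - {z}) (\<tau> \<circ> \<gamma>)"
      using cyclic_map_bypass[OF \<gamma>(1) V(2)] \<gamma>(2) c(3) by (simp add: \<tau>_def)
    show "bij_betw (b k) (V - {z}) (V - {k})"
      using V(2) k bz[OF k] by (intro bij_betw_DiffI[OF bij_b[OF k]]) (auto simp: bij_betw_def)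
    show "(\<beta>' k \<circ> a k) (b k v) = b k ((\<tau> \<circ> \<gamma>) v)" if "v \<in> V - {z}" for v
      using that ab k kK by (simp add: \<beta>'_def)
  qed
  have "\<beta>' k z = k" if "k \<in> K" for k
    using that K(1) bz \<gamma>(2) by (auto simp: \<beta>'_def \<tau>_def)
  then have "layer_maps V K z a b \<beta> \<beta>'"
    using a_col b_col \<beta>_col \<beta>'_col ab ba az ak cyc cyc' cyc_bypass by unfold_locales
  then show ?thesis by blast
qed

text \<open>The maps in \<open>F\<close> differ at every vertex, so all out-degrees equal
  \<open>card F\<close>; if \<open>z\<close> is joined to all other vertices, so is every
  vertex.\<close>

lemma complete_symmetricI:
  assumes D: "pair_digraph D" and F: "\<And>f. f \<in> F \<Longrightarrow> cyclic_map (pverts D) f"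
    and disj: "\<And>f g x. f \<in> F \<Longrightarrow> g \<in> F \<Longrightarrow> x \<in> pverts D \<Longrightarrow> f x = g x \<Longrightarrow> f = g"
    and parcs: "parcs D = {(x, f x) | x f. x \<in> pverts D \<and> f \<in> F}"
    and z: "z \<in> pverts D" "pverts D - {z} \<subseteq> (\<lambda>f. f z) ` F"
  shows "complete_symmetric D"
proof -
  interpret D: pair_digraph D by fact
  have fin: "finite (pverts D)" using D.pair_finite_verts .
  have card_out: "card ((\<lambda>f. f x) ` F) = card F" if "x \<in> pverts D" for x
    using disj that by (intro card_image inj_onI) blast
  have out_sub: "(\<lambda>f. f x) ` F \<subseteq> pverts D - {x}" if x: "x \<in> pverts D" for x
  proof clarify
    fix f assume f: "f \<in> F"
    then have "(x, f x) \<in> parcs D" using parcs x by blast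
    then show "f x \<in> pverts D - {x}"
      using D.pair_no_loops cyclic_map_closed[OF F[OF f] x] by force
  qed
  have "(\<lambda>f. f z) ` F = pverts D - {z}" using out_sub[OF z(1)] z(2) by blast
  then have "card F = card (pverts D) - 1" using card_out[OF z(1)] fin z(1) by simp
  then have "(\<lambda>f. f x) ` F = pverts D - {x}" if "x \<in> pverts D" for x
    using out_sub[OF that] card_out[OF that] fin that by (intro card_subset_eq) auto
  then have "parcs D = {(u, v). (u, v) \<in> pverts D \<times> pverts D \<and> u \<noteq> v}"
    unfolding parcs by (auto simp: set_eq_iff image_iff)
  then show ?thesis
    unfolding complete_symmetric_def complete_digraph_pair_def using fin by simp
qed

section \<open>Assembling the cycles of the wreath product\<close>

theorem theorem1p5:
  fixes G :: "'a pair_pre_digraph" and H :: "'b pair_pre_digraph"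
  assumes "pair_digraph G" and "pair_digraph H"
    and "hamiltonian_decomposable G" and "hamiltonian_decomposable H"
    and "even (card (pverts G))"
    and "card (pverts H) > 3"
    and "\<not> directed_cycle H" and "\<not> complete_symmetric H"
    and "\<not> (directed_cycle G \<and> even (card (pverts H)) \<and>
            (\<exists>\<C>. hamiltonian_decomposition H \<C> \<and> odd (card \<C>)))"
  shows "hamiltonian_decomposable (wreath G H)"
proof -
  interpret H: pair_digraph H by fact
  let ?I = "pverts G" and ?V = "pverts H"
  obtain F where F: "F \<noteq> {}" "\<And>f. f \<in> F \<Longrightarrow> cyclic_map ?I f"
    "\<And>f g x. f \<in> F \<Longrightarrow> g \<in> F \<Longrightarrow> x \<in> ?I \<Longrightarrow> f x = g x \<Longrightarrow> f = g"
    "parcs G = {(x, f x) | x f. x \<in> ?I \<and> f \<in> F}"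
    by (rule hamiltonian_decomposable_cyclic_maps[OF assms(3)]) (rule that)
  obtain E where E: "E \<noteq> {}" "\<And>d. d \<in> E \<Longrightarrow> cyclic_map ?V d"
    "\<And>d e x. d \<in> E \<Longrightarrow> e \<in> E \<Longrightarrow> x \<in> ?V \<Longrightarrow> d x = e x \<Longrightarrow> d = e"
    "parcs H = {(x, d x) | x d. x \<in> ?V \<and> d \<in> E}"
    by (rule hamiltonian_decomposable_cyclic_maps[OF assms(4)]) (rule that)
  obtain f0 where f0: "f0 \<in> F" using F(1) by blast
  obtain g0 where g0: "g0 \<in> ?I" using cyclic_map_nonempty[OF F(2)[OF f0]] by blast
  have finV: "finite ?V" using H.pair_finite_verts .
  obtain z where z: "z \<in> ?V" using assms(6) by (metis card.empty equals0I not_less_zero)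
  have FI: "f g \<in> ?I" "f g \<noteq> g" if "f \<in> F" "g \<in> ?I" for f g
    using cyclic_map_closed[OF F(2)] cyclic_map_no_fixed_point[OF F(2)] that assms(5) by auto
  have EV: "d v \<in> ?V" "d v \<noteq> v" if "d \<in> E" "v \<in> ?V" for d v
    using cyclic_map_closed[OF E(2)] cyclic_map_no_fixed_point[OF E(2)] that assms(6) by auto
  define K where "K = (\<lambda>d. d z) ` E"
  have "K \<subseteq> ?V" "K \<noteq> {}" using EV(1) z E(1) by (auto simp: K_def)
  moreover have "z \<notin> K" unfolding K_def using EV(2)[OF _ z] by (metis imageE)
  ultimately have K: "K \<subseteq> ?V" "z \<notin> K" "K \<noteq> {}" by auto
  \<comment> \<open>A single out-neighbour of \<open>z\<close> would mean a single cycle in the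
    decomposition, which would be all of \<open>H\<close>.\<close>
  have cardK: "card K \<noteq> 1"
  proof
    assume "card K = 1"
    moreover have "card K = card E"
      unfolding K_def using E(3) z by (intro card_image inj_onI) blast
    ultimately obtain d where "E = {d}" by (auto simp: card_1_singleton_iff)
    then have "directed_cycle H"
      unfolding directed_cycle_iff using assms(2) E(2)[of d] E(4) by (intro conjI exI[of _ d]) auto
    then show False using assms(7) by contradiction
  qed
  have "\<not> ?V - {z} \<subseteq> K"
  proof
    assume "?V - {z} \<subseteq> K"
    then have "complete_symmetric H"
      unfolding K_def by (intro complete_symmetricI[OF assms(2) E(2,3,4) z]) auto
    then show False using assms(8) by contradiction
  qed
  then obtain c where c: "c \<in> ?V" "c \<notin> K" "c \<noteq> z" by blast
  obtain a b \<beta> \<beta>' where "layer_maps ?V K z a b \<beta> \<beta>'"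
    using layer_maps_exist[OF finV z K cardK c] by blast
  then interpret layer_maps ?V K z a b \<beta> \<beta>' .
  \<comment> \<open>Normalising every colouring at \<open>g0\<close> makes \<open>g0\<close> the
    common closing layer for all cycles of \<open>G\<close>.\<close>
  have "\<forall>f\<in>F. \<exists>P. P g0 \<and> (\<forall>g\<in>?I. P (f g) \<longleftrightarrow> \<not> P g)"
    using cyclic_map_two_colouring[OF F(2) assms(5) g0] by blast
  then obtain par where par: "\<And>f. f \<in> F \<Longrightarrow> par f g0"
    "\<And>f g. f \<in> F \<Longrightarrow> g \<in> ?I \<Longrightarrow> par f (f g) \<longleftrightarrow> \<not> par f g" by metis
  define close where "close f = (if f = f0 then \<beta>' else \<beta>)" for f
  define \<sigma> where "\<sigma> f g k v = (if par f g then a k v else if f g = g0 then close f k v else b k v)"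
    for f g k v
  have \<sigma>: "bij_betw (\<lambda>k. \<sigma> f g k v) ?V ?V" if "v \<in> ?V" for f g v
    using a_column[OF that] b_column[OF that] \<beta>_column[OF that] \<beta>'_column[OF that]
    by (cases "par f g"; cases "f g = g0"; cases "f = f0") (simp_all add: \<sigma>_def close_def)
  have \<sigma>V: "\<sigma> f g k v \<in> ?V" if "v \<in> ?V" "k \<in> ?V" for f g k v
    using bij_betwE[OF \<sigma>[OF that(1)]] that(2) by blast
  have \<sigma>_inj: "k = k'" if "\<sigma> f g k v = \<sigma> f g k' v" "v \<in> ?V" "k \<in> ?V" "k' \<in> ?V" for f g k k' v
    using inj_onD[OF bij_betw_imp_inj_on[OF \<sigma>[OF that(2)]] that(1,3,4)] .
  \<comment> \<open>Along \<open>f0\<close>, row \<open>k\<close> in \<open>K\<close> sends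
    \<open>z\<close> to \<open>k\<close> in all layers, including the closing one; exactly these
    jumps are handed over to the cycles of \<open>H\<close>.\<close>
  have \<sigma>z: "\<sigma> f0 g k z = k" if "k \<in> K" for g k
  proof -
    have k: "k \<in> ?V" using that K by blast
    have "b k z = k" using b_a[OF k k] a_diag[OF k] by simp
    then show ?thesis using a_z[OF k] \<beta>'_z[OF that] by (simp add: \<sigma>_def close_def)
  qed
  have aV: "a k v \<in> ?V" and bV: "b k v \<in> ?V" and closeV: "close f k v \<in> ?V"
    if "k \<in> ?V" "v \<in> ?V" for k v f
    using bij_betwE[OF a_column] bij_betwE[OF b_column] bij_betwE[OF \<beta>_column]
      bij_betwE[OF \<beta>'_column] that
    by (auto simp: close_def)
  \<comment> \<open>An index \<open>Inl (f, k)\<close> follows \<open>f\<close> through the layers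
    using row \<open>k\<close>, detouring inside the copy at \<open>z\<close> when
    \<open>f = f0\<close> and \<open>k \<in> K\<close>; an index \<open>Inr d\<close> is the cycle
    \<open>d\<close> spliced over all copies.\<close>
  define T where "T i x = (case i of
      Inl (f, k) \<Rightarrow> if snd x = z \<and> f = f0 \<and> k \<in> K then (fst x, k)
        else (f (fst x), \<sigma> f (fst x) k (snd x))
    | Inr d \<Rightarrow> if snd x = z then (f0 (fst x), d z) else (fst x, d (snd x)))" for i x
  have TInl: "T (Inl (f, k)) (g, v) = (if v = z \<and> f = f0 \<and> k \<in> K then (g, k) else (f g, \<sigma> f g k v))"
    and TInr: "T (Inr d) (g, v) = (if v = z then (f0 g, d z) else (g, d v))" for f k d g v
    by (auto simp: T_def)
  have pverts: "pverts (wreath G H) = ?I \<times> ?V" by (simp add: wreath_def)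
  show ?thesis
  proof (rule hamiltonian_decomposableI[where I = "(F \<times> ?V) <+> E" and T = T])
    show "pair_digraph (wreath G H)" using assms(1,2) by (rule pair_digraph_wreath)
    show "(F \<times> ?V) <+> E \<noteq> {}" using E(1) by blast
  next
    fix i assume "i \<in> (F \<times> ?V) <+> E"
    then consider f k where "i = Inl (f, k)" "f \<in> F" "k \<in> ?V" "f = f0" "k \<in> K"
      | f k where "i = Inl (f, k)" "f \<in> F" "k \<in> ?V" "\<not> (f = f0 \<and> k \<in> K)"
      | d where "i = Inr d" "d \<in> E" by blast
    then have "cyclic_map (?I \<times> ?V) (T i)"
    proof cases
      case (1 f k)
      have "z \<noteq> k" using 1 K by blast
      then show ?thesis
        using 1 par finV z aV[of k] bV[of k] a_b[of k] b_a[of k] a_z a_diag closeV[of k _ f]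
          \<beta>'_cyclic_bypass[of k]
        by (intro cyclic_map_layers_bypass[OF F(2)[OF 1(2)] g0, where par = "par f" and a = "a k"
              and b = "b k" and \<beta> = "close f k" and z = z and k = k])
          (auto simp: TInl \<sigma>_def close_def)
    next
      case (2 f k)
      then show ?thesis
        using par finV z aV[of k] bV[of k] a_b[of k] b_a[of k] closeV[of k _ f]
          \<beta>_cyclic[of k] \<beta>'_cyclic[of k]
        by (intro cyclic_map_layers[OF F(2)[OF 2(2)] g0, where par = "par f" and a = "a k"
              and b = "b k" and \<beta> = "close f k"])
          (auto simp: TInl \<sigma>_def close_def)
    next
      case (3 d)
      then show ?thesis
        using cyclic_map_spliced_copies[OF F(2)[OF f0] E(2)[OF 3(2)] z] TInr by simp
    qed
    then show "cyclic_map (pverts (wreath G H)) (T i)" unfolding pverts .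
  next
    \<comment> \<open>The only possible clash is a jump from \<open>z\<close> to \<open>d z\<close>
      along \<open>f0\<close>; the Latin property forces \<open>k = d z\<close>, and that row makes
      its detour there.\<close>
    have rows: "False" if "T (Inl (f, k)) (g, v) = T (Inr d) (g, v)"
      "f \<in> F" "k \<in> ?V" "d \<in> E" "g \<in> ?I" "v \<in> ?V" for f k d g v
    proof (cases "v = z \<and> \<not> (f = f0 \<and> k \<in> K)")
      case True
      then have "f g = f0 g" "\<sigma> f g k z = d z" using that(1) by (auto simp: TInl TInr)
      then have "f = f0" "\<sigma> f0 g k z = d z" using F(3)[OF that(2) f0 that(5)] by auto
      moreover have "d z \<in> K" using that(4) by (simp add: K_def)
      ultimately have "\<sigma> f0 g k z = \<sigma> f0 g (d z) z" using \<sigma>z by simp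
      then have "k = d z" using \<sigma>_inj that(3,4) z EV by blast
      then show False using True \<open>f = f0\<close> \<open>d z \<in> K\<close> by blast
    next
      case False
      then show False
        using that FI(2)[OF f0 that(5)] FI(2)[OF that(2,5)] by (auto simp: TInl TInr split: if_splits)
    qed
    fix i j x assume ij: "i \<in> (F \<times> ?V) <+> E" "j \<in> (F \<times> ?V) <+> E"
      and x: "x \<in> pverts (wreath G H)" and eq: "T i x = T j x"
    obtain g v where x_eq: "x = (g, v)" and g: "g \<in> ?I" and v: "v \<in> ?V" using x pverts by auto
    show "i = j"
    proof (cases i; cases j)
      fix fk fk' assume *: "i = Inl fk" "j = Inl fk'"
      obtain f k where fk: "fk = (f, k)" "f \<in> F" "k \<in> ?V" using * ij by auto
      obtain f' k' where fk': "fk' = (f', k')" "f' \<in> F" "k' \<in> ?V" using * ij by auto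
      have "f = f' \<and> k = k'"
        using eq FI(2)[OF fk(2) g] FI(2)[OF fk'(2) g] F(3)[OF fk(2) fk'(2) g]
          \<sigma>_inj[OF _ v fk(3) fk'(3)]
        unfolding * fk fk' x_eq TInl by (auto split: if_splits)
      then show "i = j" using * fk fk' by simp
    next
      fix fk d assume *: "i = Inl fk" "j = Inr d"
      then show "i = j" using ij eq rows[of _ _ g v d] x_eq g v by (cases fk) auto
    next
      fix fk d assume *: "i = Inr d" "j = Inl fk"
      then show "i = j" using ij eq rows[of _ _ g v d] x_eq g v by (cases fk) auto
    next
      fix d d' assume *: "i = Inr d" "j = Inr d'"
      have "d v = d' v" using eq by (auto simp: * x_eq TInr split: if_splits)
      then show "i = j" using E(3) ij v * by blast
    qed
  next
    show "parcs (wreath G H) = {(x, T i x) | x i. x \<in> pverts (wreath G H) \<and> i \<in> (F \<times> ?V) <+> E}"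
      (is "_ = ?R")
    proof (intro equalityI subsetI)
      fix e assume "e \<in> parcs (wreath G H)"
      then obtain g v g' v' where e: "e = ((g, v), (g', v'))" and gv: "g \<in> ?I" "v \<in> ?V" "g' \<in> ?I" "v' \<in> ?V"
        and arc: "(g, g') \<in> parcs G \<or> g = g' \<and> (v, v') \<in> parcs H"
        unfolding wreath_def by auto
      have "\<exists>i\<in>(F \<times> ?V) <+> E. T i (g, v) = (g', v')"
        using arc
      proof
        assume "(g, g') \<in> parcs G"
        then obtain f where f: "f \<in> F" "g' = f g" using F(4) by auto
        have "v' \<in> (\<lambda>k. \<sigma> f g k v) ` ?V"
          using bij_betw_imp_surj_on[OF \<sigma>[OF gv(2)]] gv(4) by simp
        then obtain k where k: "k \<in> ?V" "v' = \<sigma> f g k v" by blast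
        show ?thesis
        \<comment> \<open>The jump from \<open>z\<close> to \<open>k = d z\<close> along
          \<open>f0\<close> belongs to the spliced cycle of \<open>d\<close>.\<close>
        proof (cases "v = z \<and> f = f0 \<and> k \<in> K")
          case True
          then obtain d where d: "d \<in> E" "k = d z" by (auto simp: K_def)
          then have "T (Inr d) (g, v) = (g', v')" using True f k \<sigma>z by (simp add: TInr)
          then show ?thesis using d by blast
        next
          case False
          then have "T (Inl (f, k)) (g, v) = (g', v')"
            unfolding TInl if_not_P[OF False] using f k by simp
          then show ?thesis using f k by blast
        qed
      next
        assume "g = g' \<and> (v, v') \<in> parcs H"
        then obtain d where d: "d \<in> E" "v' = d v" "g' = g" using E(4) by auto
        show ?thesis
        \<comment> \<open>Conversely, the arc from \<open>z\<close> to \<open>d z\<close> inside a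
          copy is the detour of row \<open>d z\<close>.\<close>
        proof (cases "v = z")
          case True
          then have "T (Inl (f0, d z)) (g, v) = (g', v')" using d by (simp add: TInl K_def)
          then show ?thesis using f0 EV[OF d(1) z] by blast
        next
          case False
          then have "T (Inr d) (g, v) = (g', v')" using d by (simp add: TInr)
          then show ?thesis using d by blast
        qed
      qed
      then obtain i where "i \<in> (F \<times> ?V) <+> E" "(g', v') = T i (g, v)" by metis
      then show "e \<in> ?R" unfolding e pverts using gv by blast
    next
      fix e assume "e \<in> ?R"
      then obtain g v i where e: "e = ((g, v), T i (g, v))" and g: "g \<in> ?I" and v: "v \<in> ?V"
        and i: "i \<in> (F \<times> ?V) <+> E" unfolding pverts by blast
      have arcG: "((g, v), (f g, w)) \<in> parcs (wreath G H)" if "f \<in> F" "w \<in> ?V" for f w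
        using that g v FI[OF that(1) g] F(4) by (auto simp: wreath_def)
      have arcH: "((g, v), (g, d v)) \<in> parcs (wreath G H)" if "d \<in> E" for d
        using that g v EV[OF that v] E(4) by (auto simp: wreath_def)
      show "e \<in> parcs (wreath G H)"
      proof (cases i)
        case (Inl fk)
        obtain f k where fk: "fk = (f, k)" "f \<in> F" "k \<in> ?V" using i Inl by auto
        show ?thesis
        proof (cases "v = z \<and> f = f0 \<and> k \<in> K")
          case True
          then obtain d where "d \<in> E" "k = d v" by (auto simp: K_def)
          then show ?thesis using arcH True by (simp add: e Inl fk TInl)
        next
          case False
          then have "T i (g, v) = (f g, \<sigma> f g k v)"
            unfolding Inl fk TInl by (rule if_not_P)
          then show ?thesis using arcG[OF fk(2)] \<sigma>V[OF v fk(3)] by (simp add: e)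
        qed
      next
        case (Inr d)
        then have d: "d \<in> E" using i by auto
        show ?thesis
          using arcH[OF d] arcG[OF f0 EV(1)[OF d z]] by (cases "v = z") (simp_all add: e Inr TInr)
      qed
    qed
  qed
qed

end
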